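(* For every integer $b\ge 1$, the state graph for $b$ balls is isomorphic (as a directed graph) to the induced subgraph of the state graph for $b+1$ balls on the set of states whose first entry is $1$.
   Context: For an integer $b\ge 1$, the state graph for $b$ balls is the infinite directed graph whose vertices (states) are the infinite $0$-$1$ sequences $\mathbf{c}=\langle c_1,c_2,\ldots\rangle$ (indexed by positive integers) containing exactly $b$ entries equal to $1$, with a directed edge $\mathbf{c}\to\mathbf{d}$ if and only if $d_i\ge c_{i+1}$ for all $i\ge 1$ (loops allowed). *)

theory Defs
  imports "Graph_Theory.Digraph_Isomorphism"
begin

text \<open>
  A sequence is a function on \<open>nat\<close>, shifted by one against the indexing by positive
  integers: \<open>c k\<close> is the entry $c_{k+1}$, so the first entry $c_1$ is \<open>c 0\<close>.
\<close>

text \<open>The finiteness conjunct rules out \<open>card\<close> of an infinite set being 0.\<close>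

definition juggling_states :: "nat \<Rightarrow> (nat \<Rightarrow> nat) set" where
  "juggling_states b =
     {c. (\<forall>i. c i \<in> {0, 1}) \<and> finite {i. c i = 1} \<and> card {i. c i = 1} = b}"

definition state_graph :: "nat \<Rightarrow> (nat \<Rightarrow> nat, (nat \<Rightarrow> nat) \<times> (nat \<Rightarrow> nat)) pre_digraph" where
  "state_graph b = with_proj
     \<lparr> pverts = juggling_states b,
       parcs = {(c, d). c \<in> juggling_states b \<and> d \<in> juggling_states b \<and> (\<forall>i. d i \<ge> c (Suc i))} \<rparr>"

lemma wf_digraph_state_graph: "wf_digraph (state_graph b)"
  by unfold_locales (auto simp: state_graph_def)

end

theory Submission
  imports Defs
begin

text \<open>Deleting the leading 1 undoes the map, so it is a bijection onto the states that start
  with 1 (\<open>image_prepend_one_states\<close>). By \<open>prepend_one_edge_iff\<close> it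
  preserves and reflects edges, so it carries the state graph exactly onto the induced
  subgraph.\<close>

text \<open>
  Prepending a 1 is the isomorphism: an edge between the extended states asks for
  $1 \ge c_1$ in the first place, which always holds, and for $d_i \ge c_{i+1}$ afterwards.
\<close>

definition prepend_one :: "(nat \<Rightarrow> nat) \<Rightarrow> nat \<Rightarrow> nat" where
  "prepend_one c = case_nat 1 c"

lemma prepend_one_0 [simp]: "prepend_one c 0 = 1"
  and prepend_one_Suc [simp]: "prepend_one c (Suc i) = c i"
  by (simp_all add: prepend_one_def)

lemma inj_prepend_one: "inj prepend_one"
proof (rule injI, rule ext)
  fix c d :: "nat \<Rightarrow> nat" and i
  assume "prepend_one c = prepend_one d"
  then show "c i = d i" by (metis prepend_one_Suc)
qed

lemma all_nat_split: "(\<forall>i. P i) \<longleftrightarrow> P 0 \<and> (\<forall>i. P (Suc i))"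
  by (metis not0_implies_Suc)

text \<open>The support moves up by one place and gains position 0, which no successor hits, so the
  count of ones grows by exactly 1.\<close>

lemma prepend_one_state_iff [simp]:
  "prepend_one c \<in> juggling_states (Suc b) \<longleftrightarrow> c \<in> juggling_states b"
proof -
  have support: "{i. prepend_one c i = 1} = insert 0 (Suc ` {i. c i = 1})"
    by (auto simp: prepend_one_def image_iff split: nat.splits) (metis not0_implies_Suc)
  have entries: "(\<forall>i. prepend_one c i \<in> {0, 1}) \<longleftrightarrow> (\<forall>i. c i \<in> {0, 1})"
    by (subst all_nat_split) simp
  show ?thesis
    unfolding juggling_states_def mem_Collect_eq support entries
    by (auto simp: finite_image_iff card_image card_insert_if)
qed

lemma image_prepend_one_states:
  "prepend_one ` juggling_states b = {c \<in> juggling_states (Suc b). c 0 = 1}"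
proof (intro equalityI subsetI)
  fix c assume c: "c \<in> {c \<in> juggling_states (Suc b). c 0 = 1}"
  \<comment> \<open>The preimage is the tail of \<open>c\<close>;
    \<open>prepend_one_state_iff\<close>, read from left to right, makes it a state with one ball
    fewer.\<close>
  then have "c = prepend_one (\<lambda>i. c (Suc i))"
    by (auto simp: prepend_one_def split: nat.splits)
  with c show "c \<in> prepend_one ` juggling_states b"
    by (metis (no_types, lifting) image_eqI mem_Collect_eq prepend_one_state_iff)
qed auto

text \<open>Index 0 contributes only \<open>c 0 \<le> 1\<close>, true because entries of a state are
  0 or 1; index \<open>Suc i\<close> gives the original inequality at \<open>i\<close>.\<close>

lemma prepend_one_edge_iff:
  assumes "c \<in> juggling_states b"
  shows "(\<forall>i. prepend_one c (Suc i) \<le> prepend_one d i) \<longleftrightarrow> (\<forall>i. c (Suc i) \<le> d i)"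
proof -
  have "c 0 \<in> {0, 1}" using assms by (simp add: juggling_states_def)
  then have "c 0 \<le> 1" by auto
  then show ?thesis by (subst all_nat_split) simp
qed

theorem theorem5p2:
  fixes b :: nat
  assumes "b \<ge> 1"
  shows "digraph_iso (state_graph b)
    (state_graph (b + 1) \<restriction> {c \<in> verts (state_graph (b + 1)). c 0 = 1})"
proof -
  \<comment> \<open>Arcs are pairs of states, so the map acts on both components and the projections
    remain tail and head.\<close>
  let ?f = "\<lparr>iso_verts = prepend_one, iso_arcs = map_prod prepend_one prepend_one,
    iso_head = snd, iso_tail = fst\<rparr>"
  let ?V = "{c \<in> juggling_states (Suc b). c 0 = 1}"
  have iso: "pre_digraph.digraph_isomorphism (state_graph b) ?f"
    unfolding pre_digraph.digraph_isomorphism_def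
    using wf_digraph_state_graph[of b]
    by (auto simp: state_graph_def intro: inj_on_subset[OF inj_prepend_one]
        inj_on_subset[OF prod.inj_map[OF inj_prepend_one inj_prepend_one]])
  \<comment> \<open>The right-hand side is the arc set of the induced subgraph.\<close>
  have arcs: "map_prod prepend_one prepend_one ` arcs (state_graph b) =
      {(c, d). c \<in> ?V \<and> d \<in> ?V \<and> (\<forall>i. c (Suc i) \<le> d i)}" (is "?L = ?R")
  proof (intro equalityI subsetI)
    fix e assume "e \<in> ?L"
    then obtain c d where "e = (prepend_one c, prepend_one d)"
      "c \<in> juggling_states b" "d \<in> juggling_states b" "\<forall>i. c (Suc i) \<le> d i"
      by (auto simp: state_graph_def)
    then show "e \<in> ?R"
      using prepend_one_edge_iff[of c b d] by simp
  next
    fix e assume e: "e \<in> ?R"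
    then have "fst e \<in> prepend_one ` juggling_states b" "snd e \<in> prepend_one ` juggling_states b"
      unfolding image_prepend_one_states by auto
    then obtain c d where cd: "e = (prepend_one c, prepend_one d)"
      "c \<in> juggling_states b" "d \<in> juggling_states b"
      by (metis imageE prod.collapse)
    with e have "(c, d) \<in> arcs (state_graph b)"
      using prepend_one_edge_iff[of c b d] by (simp add: state_graph_def)
    with cd show "e \<in> ?L" by force
  qed
  \<comment> \<open>\<open>digraph_iso\<close> asks for the target to equal the image graph as a
    record, so the fields are compared one by one.\<close>
  have "state_graph (b + 1) \<restriction> {c \<in> verts (state_graph (b + 1)). c 0 = 1} =
      app_iso ?f (state_graph b)"
  proof (rule pre_digraph.equality)
    show "arcs (state_graph (b + 1) \<restriction> {c \<in> verts (state_graph (b + 1)). c 0 = 1}) =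
        arcs (app_iso ?f (state_graph b))"
      using arcs by (auto simp: state_graph_def)
  qed (auto simp: state_graph_def image_prepend_one_states)
  with iso show ?thesis
    unfolding digraph_iso_def by blast
qed

end
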